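(* Let $x\in(0,1)$ be irrational and let $k\geq 1$. If a positive integer $q$ equals $q_{k+2}$ for some proper continued fraction expansion of $x$, then $q$ equals $q_k$ for a different proper continued fraction expansion of $x$.
   Context: A proper continued fraction (PCF) expansion of an irrational $x\in(0,1)$ consists of sequences of positive integers $(a_n)_{n\ge1}$, $(b_n)_{n\ge1}$ with $b_n\ge a_n$ for all $n$ such that $$x=\cfrac{a_1}{b_1+\cfrac{a_2}{b_2+\ddots}},$$ meaning $x=\lim_{n\to\infty}p_n/q_n$, where $p_{-1}=1,\ p_0=0,\ q_{-1}=0,\ q_0=1$ and $p_n=b_np_{n-1}+a_np_{n-2}$, $q_n=b_nq_{n-1}+a_nq_{n-2}$ for $n\ge1$ (common factors of $p_n,q_n$ are not cancelled). For a given sequence of numerators $(a_n)$ the expansion is unique and is produced by $x_0=x$, $b_n=\lfloor a_n/x_{n-1}\rfloor$, $x_n=a_n/x_{n-1}-b_n$. *)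

theory Defs
  imports Complex_Main
begin

text \<open>
  The sequences \<open>(a\<^sub>n)\<close>, \<open>(b\<^sub>n)\<close> with \<open>n \<ge> 1\<close> are encoded as functions on \<open>nat\<close>
  whose value at \<open>0\<close> is irrelevant. The initial values \<open>p\<^bsub>-1\<^esub> = 1\<close> and \<open>q\<^bsub>-1\<^esub> = 0\<close> are
  substituted into the recursion at \<open>n = 1\<close>, so that \<open>pcf_p a b n\<close> and \<open>pcf_q a b n\<close> are
  \<open>p\<^sub>n\<close> and \<open>q\<^sub>n\<close> without an index shift.
\<close>

fun pcf_p :: "(nat \<Rightarrow> nat) \<Rightarrow> (nat \<Rightarrow> nat) \<Rightarrow> nat \<Rightarrow> nat" where
  "pcf_p a b 0 = 0"
| "pcf_p a b (Suc 0) = b 1 * 0 + a 1 * 1"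
| "pcf_p a b (Suc (Suc n)) =
     b (Suc (Suc n)) * pcf_p a b (Suc n) + a (Suc (Suc n)) * pcf_p a b n"

fun pcf_q :: "(nat \<Rightarrow> nat) \<Rightarrow> (nat \<Rightarrow> nat) \<Rightarrow> nat \<Rightarrow> nat" where
  "pcf_q a b 0 = 1"
| "pcf_q a b (Suc 0) = b 1 * 1 + a 1 * 0"
| "pcf_q a b (Suc (Suc n)) =
     b (Suc (Suc n)) * pcf_q a b (Suc n) + a (Suc (Suc n)) * pcf_q a b n"

definition pcf_expansion :: "real \<Rightarrow> (nat \<Rightarrow> nat) \<Rightarrow> (nat \<Rightarrow> nat) \<Rightarrow> bool" where
  "pcf_expansion x a b \<longleftrightarrow>
     (\<forall>n\<ge>1. a n \<ge> 1 \<and> b n \<ge> 1 \<and> b n \<ge> a n) \<and>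
     (\<lambda>n. real (pcf_p a b n) / real (pcf_q a b n)) \<longlonglongrightarrow> x"

text \<open>Only the indices \<open>n \<ge> 1\<close> count when two expansions are compared.\<close>

definition pcf_different ::
    "(nat \<Rightarrow> nat) \<Rightarrow> (nat \<Rightarrow> nat) \<Rightarrow> (nat \<Rightarrow> nat) \<Rightarrow> (nat \<Rightarrow> nat) \<Rightarrow> bool" where
  "pcf_different a b a' b' \<longleftrightarrow> (\<exists>n\<ge>1. a n \<noteq> a' n \<or> b n \<noteq> b' n)"

end

theory Submission imports Defs begin

text \<open>
  With \<open>D\<^sub>n = x q\<^sub>n - p\<^sub>n\<close>, the tails \<open>x\<^sub>n = -D\<^sub>n / D\<^bsub>n-1\<^esub>\<close> of an expansion lie in the unit interval
  and satisfy \<open>x\<^sub>n = a\<^sub>n / x\<^bsub>n-1\<^esub> - b\<^sub>n\<close>; conversely any such sequence of tails gives an expansion.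
  Writing \<open>q\<^bsub>k+2\<^esub>\<close> and \<open>p\<^bsub>k+2\<^esub>\<close> as the same combination
  \<open>b' q\<^bsub>k-1\<^esub> + a' q\<^bsub>k-2\<^esub>\<close>, \<open>b' p\<^bsub>k-1\<^esub> + a' p\<^bsub>k-2\<^esub>\<close> by unfolding the recursion three times, one has
  \<open>a' / x\<^bsub>k-1\<^esub> - b' = x\<^sub>k x\<^bsub>k+1\<^esub> x\<^bsub>k+2\<^esub>\<close>, which is again in the unit interval. So \<open>(a', b')\<close> may
  replace \<open>(a\<^sub>k, b\<^sub>k)\<close>, and the expansion continues with the regular continued fraction of that tail.
\<close>

definition pcf_tails :: "(nat \<Rightarrow> nat) \<Rightarrow> (nat \<Rightarrow> nat) \<Rightarrow> (nat \<Rightarrow> real) \<Rightarrow> bool" where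
  "pcf_tails a b t \<longleftrightarrow>
     (\<forall>n. 0 < t n \<and> t n < 1 \<and> 1 \<le> a (Suc n) \<and>
          t (Suc n) = real (a (Suc n)) / t n - real (b (Suc n)))"

definition pcf_diff :: "real \<Rightarrow> (nat \<Rightarrow> nat) \<Rightarrow> (nat \<Rightarrow> nat) \<Rightarrow> nat \<Rightarrow> real" where
  "pcf_diff x a b n = x * real (pcf_q a b n) - real (pcf_p a b n)"

lemma pcf_diff_simps:
  "pcf_diff x a b 0 = x"
  "pcf_diff x a b (Suc 0) = x * real (b 1) - real (a 1)"
  "pcf_diff x a b (Suc (Suc n)) =
     real (b (Suc (Suc n))) * pcf_diff x a b (Suc n) + real (a (Suc (Suc n))) * pcf_diff x a b n"
  by (simp_all add: pcf_diff_def algebra_simps)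

text \<open>The lower bound 1 lets each step of the recursion gain at least one. The growth turns
  bounded \<open>pcf_diff\<close> into convergence of the quotients.\<close>

lemma pcf_q_ge:
  assumes "\<And>n. 1 \<le> a (Suc n)" "\<And>n. 1 \<le> b (Suc n)"
  shows "1 \<le> pcf_q a b n \<and> n \<le> pcf_q a b n"
proof (induction n rule: induct_nat_012)
  case (ge2 n)
  have "1 * pcf_q a b (Suc n) \<le> b (Suc (Suc n)) * pcf_q a b (Suc n)"
    "1 * pcf_q a b n \<le> a (Suc (Suc n)) * pcf_q a b n"
    using assms by (intro mult_le_mono1; simp)+
  with ge2 show ?case unfolding pcf_q.simps(3) by linarith
qed (use assms[of 0] in auto)

lemma pcf_diff_nonzero:
  assumes "x \<notin> \<rat>" "1 \<le> pcf_q a b n"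
  shows "pcf_diff x a b n \<noteq> 0"
proof
  assume "pcf_diff x a b n = 0"
  then have "x = real (pcf_p a b n) / real (pcf_q a b n)"
    using assms(2) by (simp add: pcf_diff_def field_simps)
  then show False using assms(1) by (metis Rats_divide Rats_of_nat)
qed

text \<open>
  Two consecutive differences of equal sign force all later ones to have that sign, with
  \<open>\<bar>x - p\<^sub>m / q\<^sub>m\<bar>\<close> bounded away from \<open>0\<close>.
\<close>

lemma pcf_diff_same_sign:
  fixes \<sigma> :: real
  assumes exp: "pcf_expansion x a b"
    and pos: "0 < \<sigma> * pcf_diff x a b n" "0 < \<sigma> * pcf_diff x a b (Suc n)"
  shows False
proof -
  let ?D = "pcf_diff x a b" and ?q = "\<lambda>m. real (pcf_q a b m)"
  have q: "0 < ?q m" for m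
    using pcf_q_ge[of a b m] exp by (simp add: pcf_expansion_def)
  \<comment> \<open>The smaller of two consecutive signed errors. It bounds all later ones from
    below, since \<open>pcf_diff\<close> and \<open>pcf_q\<close> obey the same recursion with
    nonnegative coefficients.\<close>
  define c where "c = min (\<sigma> * ?D n / ?q n) (\<sigma> * ?D (Suc n) / ?q (Suc n))"
  have "0 < c" using pos q by (simp add: c_def)
  have low: "c * ?q (n + m) \<le> \<sigma> * ?D (n + m) \<and> c * ?q (Suc (n + m)) \<le> \<sigma> * ?D (Suc (n + m))" for m
  proof (induction m)
    case 0
    have "c \<le> \<sigma> * ?D n / ?q n" "c \<le> \<sigma> * ?D (Suc n) / ?q (Suc n)" by (auto simp: c_def)
    then show ?case using q[of n] q[of "Suc n"] by (simp add: pos_le_divide_eq)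
  next
    case (Suc m)
    let ?j = "n + m"
    have "real (b (Suc (Suc ?j))) * (c * ?q (Suc ?j)) \<le> real (b (Suc (Suc ?j))) * (\<sigma> * ?D (Suc ?j))"
      "real (a (Suc (Suc ?j))) * (c * ?q ?j) \<le> real (a (Suc (Suc ?j))) * (\<sigma> * ?D ?j)"
      using Suc by (auto intro: mult_left_mono)
    then have "c * ?q (Suc (Suc ?j)) \<le> \<sigma> * ?D (Suc (Suc ?j))"
      by (simp add: pcf_diff_simps algebra_simps)
    then show ?case using Suc by simp
  qed
  have "(\<lambda>m. real (pcf_p a b m) / ?q m) \<longlonglongrightarrow> x" using exp by (simp add: pcf_expansion_def)
  then have "(\<lambda>m. \<sigma> * (x - real (pcf_p a b m) / ?q m)) \<longlonglongrightarrow> \<sigma> * (x - x)"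
    by (intro tendsto_intros)
  then have "(\<lambda>m. \<sigma> * ?D m / ?q m) \<longlonglongrightarrow> 0"
    using q by (simp add: pcf_diff_def diff_divide_distrib right_diff_distrib less_imp_neq[THEN not_sym])
  moreover have "\<exists>N. \<forall>m\<ge>N. c \<le> \<sigma> * ?D m / ?q m"
  proof (intro exI allI impI)
    fix m assume "n \<le> m"
    then show "c \<le> \<sigma> * ?D m / ?q m"
      using low[of "m - n"] q[of m] by (simp add: pos_le_divide_eq)
  qed
  ultimately have "c \<le> 0" by (rule LIMSEQ_le_const)
  with \<open>0 < c\<close> show False by simp
qed

lemma pcf_expansion_imp_tails:
  assumes x: "0 < x" "x \<notin> \<rat>" and exp: "pcf_expansion x a b"
  obtains t where "pcf_tails a b t" "t 0 = x"
proof -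
  let ?D = "pcf_diff x a b"
  have ab: "1 \<le> a (Suc n)" "1 \<le> b (Suc n)" "a (Suc n) \<le> b (Suc n)" for n
    using exp by (auto simp: pcf_expansion_def)
  have nz: "?D n \<noteq> 0" for n
    using pcf_diff_nonzero x(2) pcf_q_ge[of a b n] ab by simp
  have alt: "?D (Suc n) / ?D n < 0" for n
    using pcf_diff_same_sign[OF exp, of 1 n] pcf_diff_same_sign[OF exp, of "-1" n]
      nz[of n] nz[of "Suc n"]
    by (auto simp: divide_less_0_iff neq_iff)
  \<comment> \<open>The value at 0 fits the same formula: the difference at index -1 is x * 0 - 1 =
    -1.\<close>
  define t where "t n = (case n of 0 \<Rightarrow> x | Suc m \<Rightarrow> - ?D (Suc m) / ?D m)" for n
  have pos: "0 < t n" for n using x(1) alt by (auto simp: t_def split: nat.split)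
  have rec: "t (Suc n) = real (a (Suc n)) / t n - real (b (Suc n))" for n
    using x(1) nz by (cases n) (simp_all add: t_def pcf_diff_simps field_simps)
  \<comment> \<open>Positivity of the next tail gives b < a / t, and a \<le> b then forces t <
    1.\<close>
  have "t n < 1" for n
  proof -
    have "real (b (Suc n)) < real (a (Suc n)) / t n" using pos[of "Suc n"] rec[of n] by simp
    then have "real (a (Suc n)) * 1 < real (a (Suc n)) / t n" using ab(3)[of n] by linarith
    then have "real (a (Suc n)) * t n < real (a (Suc n)) * 1"
      using pos[of n] by (simp add: pos_less_divide_eq)
    then show ?thesis using ab(1)[of n] by simp
  qed
  then have "pcf_tails a b t" using pos rec ab by (simp add: pcf_tails_def)
  moreover have "t 0 = x" by (simp add: t_def)
  ultimately show ?thesis by (rule that)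
qed

text \<open>Each difference is -t times the preceding one, so all stay bounded by 1, while the
  denominators grow at least linearly; the error is at most 1 / n.\<close>

lemma pcf_tails_imp_expansion:
  assumes t: "pcf_tails a b t"
  shows "pcf_expansion (t 0) a b"
proof -
  let ?D = "pcf_diff (t 0) a b" and ?q = "\<lambda>m. real (pcf_q a b m)"
  have T: "0 < t n" "t n < 1" "1 \<le> a (Suc n)" for n using t by (auto simp: pcf_tails_def)
  have rec: "t (Suc n) = real (a (Suc n)) / t n - real (b (Suc n))" for n
    using t by (simp add: pcf_tails_def)
  \<comment> \<open>Both tails are below 1, hence a \<le> a / t < b + 1, and integrality removes the
    1.\<close>
  have ab: "a (Suc n) \<le> b (Suc n)" for n
  proof -
    have "real (a (Suc n)) * t n \<le> real (a (Suc n)) * 1"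
      using T(2)[of n] by (intro mult_left_mono) auto
    then have "real (a (Suc n)) \<le> real (a (Suc n)) / t n"
      using T(1)[of n] by (simp add: pos_le_divide_eq)
    then have "real (a (Suc n)) < real (b (Suc n)) + 1" using rec[of n] T(2)[of "Suc n"] by simp
    then show ?thesis by linarith
  qed
  have b1: "1 \<le> b (Suc n)" for n using ab T(3) order_trans by blast
  have q: "1 \<le> ?q n" "real n \<le> ?q n" for n using pcf_q_ge[of a b n] T(3) b1 by auto
  have step: "?D (Suc n) = - t (Suc n) * ?D n" for n
  proof (induction n)
    case 0
    then show ?case using T(1)[of 0] by (simp add: pcf_diff_simps rec field_simps)
  next
    case (Suc n)
    have "real (a (Suc (Suc n))) = t (Suc n) * (t (Suc (Suc n)) + real (b (Suc (Suc n))))"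
      using T(1)[of "Suc n"] rec[of "Suc n"] by (simp add: field_simps)
    then show ?case unfolding pcf_diff_simps(3) Suc by (simp add: algebra_simps)
  qed
  have bound: "\<bar>?D n\<bar> \<le> 1" for n
  proof (induction n)
    case 0
    then show ?case using T[of 0] by (simp add: pcf_diff_simps)
  next
    case (Suc n)
    then show ?case using T[of "Suc n"] by (simp add: step abs_mult mult_le_one)
  qed
  have "(\<lambda>n. real (pcf_p a b n) / ?q n - t 0) \<longlonglongrightarrow> 0"
  proof (rule tendsto_rabs_zero_cancel, rule tendsto_sandwich[where f = "\<lambda>_. 0"])
    show "\<forall>\<^sub>F n in sequentially. \<bar>real (pcf_p a b n) / ?q n - t 0\<bar> \<le> 1 / real n"
    proof (rule eventually_sequentiallyI[of 1])
      fix n :: nat assume "1 \<le> n"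
      have "real (pcf_p a b n) / ?q n - t 0 = - ?D n / ?q n"
        using q(1)[of n] by (simp add: pcf_diff_def field_simps)
      then have "\<bar>real (pcf_p a b n) / ?q n - t 0\<bar> = \<bar>?D n\<bar> / ?q n" by simp
      also have "\<dots> \<le> 1 / real n"
        using \<open>1 \<le> n\<close> q(2)[of n] bound[of n] by (intro frac_le) auto
      finally show "\<bar>real (pcf_p a b n) / ?q n - t 0\<bar> \<le> 1 / real n" .
    qed
    show "(\<lambda>n. 1 / real n) \<longlonglongrightarrow> 0" by (rule lim_1_over_n)
  qed simp_all
  then have "(\<lambda>n. real (pcf_p a b n) / ?q n) \<longlonglongrightarrow> t 0" by (simp add: LIM_zero_iff)
  moreover have "1 \<le> a n \<and> 1 \<le> b n \<and> a n \<le> b n" if "1 \<le> n" for n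
    using that ab b1 T(3) by (cases n) auto
  ultimately show ?thesis by (simp add: pcf_expansion_def)
qed

text \<open>Solving the recursion for the earlier tail shows that a rational tail would have a
  rational predecessor.\<close>

lemma pcf_tails_irrational:
  assumes "pcf_tails a b t" "t 0 \<notin> \<rat>"
  shows "t n \<notin> \<rat>"
proof (induction n)
  case (Suc n)
  have t: "0 < t n" "1 \<le> a (Suc n)" "t (Suc n) = real (a (Suc n)) / t n - real (b (Suc n))"
    using assms(1) by (auto simp: pcf_tails_def)
  then have "t (Suc n) + real (b (Suc n)) \<noteq> 0" by simp
  then have "t n = real (a (Suc n)) / (t (Suc n) + real (b (Suc n)))"
    using t(1,3) by (simp add: nonzero_eq_divide_eq distrib_left)
  then show ?case using Suc by (metis Rats_add Rats_divide Rats_of_nat)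
qed (use assms in simp)

text \<open>The tails are the orbit of \<open>y\<close> under the Gauss map; irrationality persists
  along it and keeps every fractional part nonzero.\<close>

lemma regular_tails_exist:
  fixes y :: real
  assumes "0 < y" "y < 1" "y \<notin> \<rat>"
  obtains b u where "pcf_tails (\<lambda>_. 1) b u" "u 0 = y"
proof -
  define u where "u n = ((\<lambda>s. frac (1 / s)) ^^ n) y" for n
  have rec: "u (Suc n) = frac (1 / u n)" for n by (simp add: u_def)
  have u: "0 < u n \<and> u n < 1 \<and> u n \<notin> \<rat>" for n
  proof (induction n)
    case 0
    then show ?case using assms by (simp add: u_def)
  next
    case (Suc n)
    have "u (Suc n) \<notin> \<rat>"
    proof
      assume "u (Suc n) \<in> \<rat>"
      then have "of_int \<lfloor>1 / u n\<rfloor> + u (Suc n) \<in> \<rat>" by simp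
      then have "1 / u n \<in> \<rat>" by (simp add: rec frac_def)
      then have "inverse (1 / u n) \<in> \<rat>" by (rule Rats_inverse)
      then show False using Suc by simp
    qed
    moreover have "u (Suc n) \<noteq> 0" using calculation by (metis Rats_0)
    ultimately show ?case using frac_ge_0[of "1 / u n"] frac_lt_1[of "1 / u n"] by (auto simp: rec)
  qed
  define b where "b n = nat \<lfloor>1 / u (n - 1)\<rfloor>" for n
  have "u (Suc n) = real 1 / u n - real (b (Suc n))" for n
    using u[of n] by (simp add: rec b_def frac_def)
  then have "pcf_tails (\<lambda>_. 1) b u" using u by (simp add: pcf_tails_def)
  moreover have "u 0 = y" by (simp add: u_def)
  ultimately show ?thesis by (rule that)
qed

lemma pcf_q_cong:
  assumes "\<And>i. 1 \<le> i \<Longrightarrow> i \<le> n \<Longrightarrow> a i = a' i \<and> b i = b' i"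
  shows "pcf_q a b n = pcf_q a' b' n"
  using assms by (induction a b n rule: pcf_q.induct) auto

theorem theorem3p9:
  fixes x :: real and k q :: nat and a b :: "nat \<Rightarrow> nat"
  assumes "0 < x" and "x < 1" and "x \<notin> \<rat>"
    and "k \<ge> 1"
    and "q > 0"
    and "pcf_expansion x a b"
    and "q = pcf_q a b (k + 2)"
  shows "\<exists>a' b'. pcf_expansion x a' b' \<and> pcf_different a b a' b' \<and> q = pcf_q a' b' k"
proof -
  obtain t where t: "pcf_tails a b t" "t 0 = x"
    using pcf_expansion_imp_tails assms by blast
  obtain m where k: "k = Suc m" using assms(4) by (cases k) auto
  have T: "0 < t n" "t n < 1" "1 \<le> a (Suc n)"
    "t (Suc n) = real (a (Suc n)) / t n - real (b (Suc n))" for n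
    using t by (auto simp: pcf_tails_def)
  txt \<open>\<open>A\<close> and \<open>B\<close> are the new \<open>a'\<close> and \<open>b'\<close>: \<open>q\<^bsub>k+2\<^esub> = B q\<^bsub>k-1\<^esub> + A q\<^bsub>k-2\<^esub>\<close>.\<close>
  define C where "C = b (k + 2) * b (k + 1) + a (k + 2)"
  define A where "A = C * a k"
  define B where "B = C * b k + b (k + 2) * a (k + 1)"
  \<comment> \<open>Three steps multiply the difference at index \<open>k - 1\<close> by
    \<open>- y\<close>; the replacement does this in one step, so \<open>y\<close> is its
    tail.\<close>
  define y where "y = t k * t (k + 1) * t (k + 2)"
  have quot: "real (a (Suc n)) = t n * (t (Suc n) + real (b (Suc n)))" for n
    using T(1)[of n] T(4)[of n] by (simp add: field_simps)
  have y_eq: "y = real A / t m - real B"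
  proof -
    have "real A / t m = real C * (t k + real (b k))"
      using quot[of m] T(1)[of m] by (simp add: A_def k)
    then have "real A / t m - real B = real C * t k - real (b (k + 2)) * real (a (k + 1))"
      by (simp add: B_def algebra_simps)
    also have "\<dots> = t k * (real (a (k + 2)) - real (b (k + 2)) * t (k + 1))"
      using quot[of k] by (simp add: C_def algebra_simps)
    also have "\<dots> = y" using quot[of "Suc k"] by (simp add: y_def algebra_simps)
    finally show ?thesis ..
  qed
  \<comment> \<open>The factor \<open>C\<close> is at least 2, so the numerator at \<open>k\<close>
    really changes and the two expansions differ.\<close>
  have "b n \<ge> 1" if "n \<ge> 1" for n using assms(6) that by (simp add: pcf_expansion_def)
  then have "1 * 1 \<le> b (k + 2) * b (k + 1)" by (intro mult_le_mono; simp)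
  moreover have "1 \<le> a (k + 2)" using T(3)[of "Suc k"] by simp
  ultimately have "2 \<le> C" unfolding C_def by linarith
  moreover have "1 \<le> a k" using T(3)[of m] k by simp
  ultimately have "2 * a k \<le> A" by (simp add: A_def)
  then have A: "1 \<le> A" "A \<noteq> a k" using \<open>1 \<le> a k\<close> by auto
  have "0 < y" using T(1) by (simp add: y_def)
  have "t k * t (k + 1) < 1 * 1" using T(1,2) by (intro mult_strict_mono) (auto intro: less_imp_le)
  then have "t k * t (k + 1) * t (k + 2) < 1 * 1"
    using T(1,2) by (intro mult_strict_mono) (auto intro: less_imp_le)
  then have "y < 1" by (simp add: y_def)
  have "y + real B \<noteq> 0" using \<open>0 < y\<close> by linarith
  then have "t m = real A / (y + real B)"
    using y_eq T(1)[of m] by simp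
  moreover have "t m \<notin> \<rat>" using pcf_tails_irrational t assms(3) by blast
  ultimately have "y \<notin> \<rat>" by (metis Rats_add Rats_divide Rats_of_nat)
  with \<open>0 < y\<close> \<open>y < 1\<close> obtain d u where u: "pcf_tails (\<lambda>_. 1) d u" "u 0 = y"
    using regular_tails_exist by blast
  define a' where "a' n = (if n < k then a n else if n = k then A else 1)" for n
  define b' where "b' n = (if n < k then b n else if n = k then B else d (n - k))" for n
  \<comment> \<open>The blocks meet at \<open>t' k = u 0 = y\<close>. Only the transition from
    \<open>m\<close> to \<open>k\<close> needs \<open>y_eq\<close>; elsewhere each block obeys its
    own recursion.\<close>
  define t' where "t' n = (if n < k then t n else u (n - k))" for n
  have "pcf_tails a' b' t'"
    unfolding pcf_tails_def
  proof
    fix n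
    consider "Suc n < k" | "n = m" | "n \<ge> k" using k by linarith
    then show "0 < t' n \<and> t' n < 1 \<and> 1 \<le> a' (Suc n) \<and>
        t' (Suc n) = real (a' (Suc n)) / t' n - real (b' (Suc n))"
    proof cases
      case 1
      then show ?thesis using T[of n] by (simp add: a'_def b'_def t'_def)
    next
      case 2
      then show ?thesis
        using T[of m] u(2) y_eq A by (simp add: a'_def b'_def t'_def k)
    next
      case 3
      then show ?thesis
        using u(1) by (simp add: a'_def b'_def t'_def pcf_tails_def Suc_diff_le)
    qed
  qed
  then have "pcf_expansion (t' 0) a' b'" by (rule pcf_tails_imp_expansion)
  then have "pcf_expansion x a' b'" using t(2) k by (simp add: t'_def)
  moreover have "pcf_different a b a' b'"
    using A(2) assms(4) by (auto simp: pcf_different_def a'_def intro!: exI[of _ k])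
  moreover have "q = pcf_q a' b' k"
  \<comment> \<open>For \<open>k = 1\<close> the index \<open>k - 2\<close> is -1, whose denominator
    0 is built into \<open>pcf_q\<close>, so \<open>B\<close> alone must equal
    \<open>q\<close>.\<close>
  proof (cases m)
    case 0
    then show ?thesis
      using assms(7) by (simp add: k a'_def b'_def A_def B_def C_def numeral_eq_Suc algebra_simps)
  next
    case (Suc j)
    have "pcf_q a' b' m = pcf_q a b m" "pcf_q a' b' j = pcf_q a b j"
      by (rule pcf_q_cong; simp add: a'_def b'_def k Suc)+
    then have "pcf_q a' b' k = B * pcf_q a b m + A * pcf_q a b j"
      by (simp add: k Suc a'_def b'_def)
    also have "\<dots> = q"
      using assms(7) by (simp add: k Suc A_def B_def C_def algebra_simps)
    finally show ?thesis ..
  qed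
  ultimately show ?thesis by blast
qed

end
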